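(* Let $H \in (0,1)$, $K\in(0,1)$ and let $Z_{H,K}$ be a trifractional Brownian motion with parameters $H$ and $K$. Let $T>0$. Suppose that $HK \le \frac{1}{2}$ and that the limit $$\ell := -\lim_{n \to \infty}\frac{1}{2n}\log_2 \sum_{k = 1}^{2^n}\left(Z_{H,K}\Big(\frac{kT}{2^n}\Big) - Z_{H,K}\Big(\frac{(k-1)T}{2^n}\Big)\right)^2$$ exists. Then $\ell = HK$ almost surely.
   Context: A trifractional Brownian motion $Z_{H,K} = \{Z_{H,K}(t), t\in[0,\infty)\}$ with parameters $H\in(0,1)$ and $K\in(0,1)$ is a centered Gaussian process with covariance function $$C_{H,K}(s,t) = t^{2HK} + s^{2HK} - (t^{2H}+s^{2H})^{K}, \qquad s,t\in[0,\infty).$$ *)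

theory Defs
  imports "HOL-Probability.Probability"
begin

(* Point masses count as Gaussian (sigma = 0): for a trifractional Brownian motion the
   covariance vanishes at time 0, so Z 0 is degenerate.  Note that
   normal_density takes the standard deviation, and that it is not a density for sigma = 0. *)
definition gaussian_rv :: "'a measure \<Rightarrow> ('a \<Rightarrow> real) \<Rightarrow> bool" where
  "gaussian_rv M X \<longleftrightarrow> X \<in> borel_measurable M \<and>
     (\<exists>\<mu> \<sigma>. \<sigma> \<ge> 0 \<and>
        distr M borel X =
          (if \<sigma> = 0 then return borel \<mu> else density lborel (normal_density \<mu> \<sigma>)))"

definition gaussian_process :: "'a measure \<Rightarrow> 'i set \<Rightarrow> ('i \<Rightarrow> 'a \<Rightarrow> real) \<Rightarrow> bool" where
  "gaussian_process M I Z \<longleftrightarrow> prob_space M \<and> (\<forall>t\<in>I. Z t \<in> borel_measurable M) \<and>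
     (\<forall>J c. finite J \<and> J \<subseteq> I \<longrightarrow> gaussian_rv M (\<lambda>\<omega>. \<Sum>t\<in>J. c t * Z t \<omega>))"

definition covariance :: "'a measure \<Rightarrow> ('a \<Rightarrow> real) \<Rightarrow> ('a \<Rightarrow> real) \<Rightarrow> real" where
  "covariance M X Y =
     (\<integral>\<omega>. (X \<omega> - (\<integral>\<eta>. X \<eta> \<partial>M)) * (Y \<omega> - (\<integral>\<eta>. Y \<eta> \<partial>M)) \<partial>M)"

definition trifractional_cov :: "real \<Rightarrow> real \<Rightarrow> real \<Rightarrow> real \<Rightarrow> real" where
  "trifractional_cov H K s t =
     t powr (2 * H * K) + s powr (2 * H * K) - (t powr (2 * H) + s powr (2 * H)) powr K"

definition trifractional_brownian_motion ::
    "real \<Rightarrow> real \<Rightarrow> 'a measure \<Rightarrow> (real \<Rightarrow> 'a \<Rightarrow> real) \<Rightarrow> bool" where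
  "trifractional_brownian_motion H K M Z \<longleftrightarrow>
     0 < H \<and> H < 1 \<and> 0 < K \<and> K < 1 \<and>
     gaussian_process M {0..} Z \<and>
     (\<forall>t\<ge>0. (\<integral>\<omega>. Z t \<omega> \<partial>M) = 0) \<and>
     (\<forall>s\<ge>0. \<forall>t\<ge>0. covariance M (Z s) (Z t) = trifractional_cov H K s t)"

(* x is a sample path.  The library sets log 2 0 = 0; for the processes considered the sum of
   squares is almost surely positive for every n, so this convention is immaterial. *)
definition log_dyadic_qv :: "real \<Rightarrow> (real \<Rightarrow> real) \<Rightarrow> nat \<Rightarrow> real" where
  "log_dyadic_qv T x n =
     1 / (2 * real n) *
     log 2 (\<Sum>k = 1..2 ^ n. (x (real k * T / 2 ^ n) - x ((real k - 1) * T / 2 ^ n))\<^sup>2)"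

end

theory Submission
  imports Defs "HOL-Real_Asymp.Real_Asymp"
begin

text \<open>
  Away from the origin the process is smooth: the variance of \<open>Z t - Z s\<close> is at most
  \<open>2 s\<^bsup>2HK-2\<^esup> (t - s)\<^sup>2\<close>.  With mesh \<open>h = T / 2\<^sup>n\<close> the \<open>k\<close>-th increment thus has variance at most
  \<open>2 h\<^bsup>2HK\<^esup> / (k - 1)\<close> for \<open>k > 1\<close> (here \<open>HK \<le> 1/2\<close> enters), so the expected sum of squares is
  \<open>O(n h\<^bsup>2HK\<^esup>)\<close>.  Conversely the first increment alone is Gaussian with variance
  \<open>(2 - 2\<^sup>K) h\<^bsup>2HK\<^esup>\<close>.  By Borel--Cantelli, with Markov's inequality from above and a small ball
  estimate from below, the sum is almost surely \<open>h\<^bsup>2HK\<^esup>\<close> up to factors polynomial in \<open>n\<close>.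
\<close>

section \<open>Gaussian random variables: second moments and small balls\<close>

text \<open>Under a point mass the square is almost everywhere the constant
  \<open>\<mu>\<^sup>2\<close>. Under a proper density it is a combination of the centered second
  moment, the first moment and the total mass. Integrability has to be secured before any
  expectation is expanded by linearity.\<close>

lemma gaussian_rv_square_integrable:
  assumes "prob_space M" "gaussian_rv M X"
  shows "integrable M (\<lambda>\<omega>. (X \<omega>)\<^sup>2)"
proof -
  obtain \<mu> \<sigma> where X [measurable]: "X \<in> borel_measurable M" and "\<sigma> \<ge> 0"
    and d: "distr M borel X = (if \<sigma> = 0 then return borel \<mu> else density lborel (normal_density \<mu> \<sigma>))"
    using assms(2) unfolding gaussian_rv_def by blast
  have "integrable (distr M borel X) (\<lambda>x. x\<^sup>2)"
  proof (cases "\<sigma> = 0")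
    case True
    interpret R: prob_space "return borel \<mu>" by (rule prob_space_return) simp
    have "integrable (return borel \<mu>) (\<lambda>x. \<mu>\<^sup>2)" by simp
    moreover have "AE x in return borel \<mu>. x\<^sup>2 = \<mu>\<^sup>2"
      by (subst AE_return) (auto simp: pred_def)
    ultimately have "integrable (return borel \<mu>) (\<lambda>x. x\<^sup>2)"
      by (subst integrable_cong_AE[where g="\<lambda>x. \<mu>\<^sup>2"]) auto
    then show ?thesis using d True by simp
  next
    case False
    then have "\<sigma> > 0" using \<open>\<sigma> \<ge> 0\<close> by simp
    \<comment> \<open>This is the expansion \<open>x\<^sup>2 = (x - \<mu>)\<^sup>2 + 2 * \<mu> * x -
      \<mu>\<^sup>2\<close>, weighted by the density.\<close>
    have "integrable lborel (\<lambda>x. normal_density \<mu> \<sigma> x * (x - \<mu>)^2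
        + 2 * \<mu> * (normal_density \<mu> \<sigma> x * x) - \<mu>\<^sup>2 * normal_density \<mu> \<sigma> x)"
      using integrable_normal_moment[OF \<open>\<sigma> > 0\<close>] integrable_normal_moment_nz_1[OF \<open>\<sigma> > 0\<close>]
        integrable_normal_density[OF \<open>\<sigma> > 0\<close>]
      by (intro Bochner_Integration.integrable_add Bochner_Integration.integrable_diff integrable_mult_right)
    then have "integrable lborel (\<lambda>x. normal_density \<mu> \<sigma> x * x^2)"
      by (rule back_subst[of "integrable lborel"]) (auto simp: fun_eq_iff power2_eq_square algebra_simps)
    then show ?thesis using d False by (simp add: integrable_density)
  qed
  then show ?thesis by (simp add: integrable_distr_eq)
qed

text \<open>A normal density is bounded by a constant over its standard deviation, so an interval
  whose length is proportional to that deviation has small mass, wherever the mean lies.\<close>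

lemma gaussian_rv_small_ball:
  assumes "prob_space M" "gaussian_rv M X"
    and v: "0 < covariance M X X" and "0 \<le> e"
  shows "measure M {\<omega> \<in> space M. \<bar>X \<omega>\<bar> \<le> e * sqrt (covariance M X X)} \<le> e"
proof -
  interpret prob_space M by fact
  obtain \<mu> \<sigma> where X [measurable]: "X \<in> borel_measurable M" and "\<sigma> \<ge> 0"
    and d: "distr M borel X = (if \<sigma> = 0 then return borel \<mu> else density lborel (normal_density \<mu> \<sigma>))"
    using assms(2) unfolding gaussian_rv_def by blast
  have cov: "covariance M X X = variance X"
    by (simp add: covariance_def power2_eq_square)
  \<comment> \<open>A point mass has variance 0, which contradicts the positive covariance.\<close>
  have "\<sigma> \<noteq> 0"
  proof
    assume "\<sigma> = 0"
    then have d0: "distr M borel X = return borel \<mu>" using d by simp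
    have "AE x in distr M borel X. x = \<mu>"
      unfolding d0 by (subst AE_return) (auto simp: pred_def)
    then have ae: "AE \<omega> in M. X \<omega> = \<mu>" by (simp add: AE_distr_iff)
    then have "expectation X = expectation (\<lambda>_. \<mu>)"
      by (intro integral_cong_AE) auto
    then have "expectation X = \<mu>" by (simp add: prob_space)
    then have "variance X = expectation (\<lambda>_. 0)"
      using ae by (intro integral_cong_AE) auto
    then show False using v cov by simp
  qed
  then have \<sigma>: "\<sigma> > 0" using \<open>\<sigma> \<ge> 0\<close> by simp
  have D: "distributed M lborel X (normal_density \<mu> \<sigma>)"
    using d \<open>\<sigma> \<noteq> 0\<close> unfolding distributed_def by (auto cong: distr_cong)
  have var: "sqrt (covariance M X X) = \<sigma>"
    using normal_distributed_variance[OF \<sigma> D] \<sigma> cov by simp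
  define r where "r = e * \<sigma>"
  have "r \<ge> 0" using \<sigma> \<open>0 \<le> e\<close> by (simp add: r_def)
  \<comment> \<open>Weakening \<open>sqrt (2 * pi)\<close> to 2 makes the final bound exactly
    \<open>e\<close>: the interval has length \<open>2 * e * \<sigma>\<close>.\<close>
  have nd: "normal_density \<mu> \<sigma> x \<le> 1 / (2 * \<sigma>)" for x
  proof -
    have "2 \<le> sqrt (2 * pi)" using pi_ge_two by (intro real_le_rsqrt) auto
    then have "2 * \<sigma> \<le> sqrt (2 * pi) * \<sigma>" using \<sigma> by simp
    then have "2 * \<sigma> \<le> sqrt (2 * pi * \<sigma>\<^sup>2)" using \<sigma> by (simp add: real_sqrt_mult)
    then have "1 / sqrt (2 * pi * \<sigma>\<^sup>2) \<le> 1 / (2 * \<sigma>)" using \<sigma> by (intro frac_le) auto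
    then have "1 / sqrt (2 * pi * \<sigma>\<^sup>2) * exp (- (x - \<mu>)\<^sup>2 / (2 * \<sigma>\<^sup>2)) \<le> 1 / (2 * \<sigma>) * 1"
      using \<sigma> by (intro mult_mono) auto
    then show ?thesis by (simp add: normal_density_def)
  qed
  have "{\<omega> \<in> space M. \<bar>X \<omega>\<bar> \<le> r} = X -` {-r..r} \<inter> space M" by auto
  then have "emeasure M {\<omega> \<in> space M. \<bar>X \<omega>\<bar> \<le> r} = emeasure (distr M borel X) {-r..r}"
    by (simp add: emeasure_distr)
  also have "\<dots> = (\<integral>\<^sup>+ x. ennreal (normal_density \<mu> \<sigma> x) * indicator {-r..r} x \<partial>lborel)"
    using d \<open>\<sigma> \<noteq> 0\<close> by (simp add: emeasure_density)
  also have "\<dots> \<le> (\<integral>\<^sup>+ x. ennreal (1 / (2 * \<sigma>)) * indicator {-r..r} x \<partial>lborel)"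
    by (intro nn_integral_mono mult_right_mono ennreal_leI nd) auto
  also have "\<dots> = ennreal (1 / (2 * \<sigma>)) * ennreal (2 * r)"
    using \<open>r \<ge> 0\<close> by (simp add: nn_integral_cmult_indicator)
  also have "\<dots> = ennreal e"
    using \<sigma> \<open>r \<ge> 0\<close> by (simp add: ennreal_mult'[symmetric] r_def)
  finally show ?thesis
    using \<open>0 \<le> e\<close> by (simp add: emeasure_eq_measure var r_def)
qed

section \<open>Deterministic bounds: increment variance and harmonic sums\<close>

text \<open>The ratio \<open>t / s\<close> is at least 1, so raising it to the power
  \<open>H\<close> gives at most the ratio itself; multiplying by \<open>s powr H\<close> gives the
  claim.\<close>

lemma powr_increment_le:
  fixes H s t :: real
  assumes "0 < s" "s \<le> t" "H \<le> 1"
  shows "t powr H - s powr H \<le> s powr (H - 1) * (t - s)"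
proof -
  have "(t / s) powr H \<le> (t / s) powr 1" using assms by (intro powr_mono) auto
  then have "s powr H * (t / s) powr H \<le> s powr H * (t / s)" using assms by (intro mult_left_mono) auto
  then show ?thesis using assms by (simp add: powr_divide powr_diff field_simps)
qed

text \<open>The left side is \<open>2 * 2 powr K\<close> times the gap in Jensen's inequality for
  the concave function \<open>x powr K\<close> at the points \<open>p\<^sup>2\<close> and
  \<open>q\<^sup>2\<close>. It vanishes for \<open>p = q\<close>; the bound shows that it does so to
  second order.\<close>

lemma jensen_gap_powr_le:
  fixes K p q :: real
  assumes "0 < q" "q \<le> p" "0 \<le> K" "K \<le> 1"
  shows "2 * (p\<^sup>2 + q\<^sup>2) powr K - 2 powr K * (p powr (2 * K) + q powr (2 * K))
    \<le> 2 * q powr (2 * K - 2) * (p - q)\<^sup>2"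
proof -
  have "p > 0" using assms by simp
  \<comment> \<open>Both terms are compared with \<open>(pq)\<^sup>K\<close>, the arithmetic mean inequality handling the second one.\<close>
  define u where "u = (p - q)\<^sup>2 / (2 * (p * q))"
  have "u \<ge> 0" using assms by (simp add: u_def)
  \<comment> \<open>Since \<open>p\<^sup>2 + q\<^sup>2 = 2 * p * q + (p - q)\<^sup>2\<close>, the
    number \<open>u\<close> is the excess over \<open>2 * p * q\<close> relative to it.\<close>
  have "p\<^sup>2 + q\<^sup>2 = 2 * (p * q) * (1 + u)"
    using assms \<open>p > 0\<close> by (simp add: u_def field_simps power2_eq_square)
  then have "(p\<^sup>2 + q\<^sup>2) powr K = 2 powr K * (p * q) powr K * (1 + u) powr K"
    using assms \<open>p > 0\<close> \<open>u \<ge> 0\<close> by (simp add: powr_mult)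
  also have "\<dots> \<le> 2 powr K * (p * q) powr K * (1 + u)"
    using \<open>u \<ge> 0\<close> assms powr_mono[of K 1 "1 + u"] by (intro mult_left_mono) auto
  finally have 1: "(p\<^sup>2 + q\<^sup>2) powr K \<le> 2 powr K * (p * q) powr K * (1 + u)" .
  have "0 \<le> (p powr K - q powr K)\<^sup>2" by simp
  also have "\<dots> = p powr (2 * K) + q powr (2 * K) - 2 * (p * q) powr K"
    using assms \<open>p > 0\<close>
    by (simp add: powr_mult power2_diff powr_power mult.commute)
  finally have "2 * (p * q) powr K \<le> p powr (2 * K) + q powr (2 * K)" by simp
  then have 2: "2 powr K * (2 * (p * q) powr K) \<le> 2 powr K * (p powr (2 * K) + q powr (2 * K))"
    by (intro mult_left_mono) auto
  \<comment> \<open>The leading terms in \<open>(p * q) powr K\<close> cancel, leaving only the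
    contribution of \<open>u\<close>, which is quadratic in \<open>p - q\<close>.\<close>
  have "2 * (p\<^sup>2 + q\<^sup>2) powr K - 2 powr K * (p powr (2 * K) + q powr (2 * K))
      \<le> 2 * 2 powr K * (p * q) powr K * u"
    using 1 2 by (simp add: algebra_simps)
  also have "\<dots> = 2 powr K * (p * q) powr (K - 1) * (p - q)\<^sup>2"
    using assms \<open>p > 0\<close> by (simp add: u_def powr_diff)
  \<comment> \<open>The exponent \<open>K - 1\<close> is not positive, so replacing
    \<open>p * q\<close> by the smaller \<open>q * q\<close> increases the power.\<close>
  also have "\<dots> \<le> 2 powr 1 * (q * q) powr (K - 1) * (p - q)\<^sup>2"
    using assms \<open>p > 0\<close> by (intro mult_right_mono mult_mono powr_mono powr_mono2') auto
  also have "(q * q) powr (K - 1) = q powr (2 * K - 2)"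
    using assms by (simp add: powr_mult powr_add[symmetric] algebra_simps)
  finally show ?thesis by simp
qed

text \<open>The result of expanding \<open>C(t,t) + C(s,s) - 2 C(s,t)\<close> for the covariance
  \<open>C\<close>, whose diagonal is
  \<open>C(t,t) = (2 - 2 powr K) * t powr (2 * H * K)\<close>.\<close>

definition trifractional_increment_variance :: "real \<Rightarrow> real \<Rightarrow> real \<Rightarrow> real \<Rightarrow> real" where
  "trifractional_increment_variance H K s t =
     2 * (t powr (2 * H) + s powr (2 * H)) powr K
     - 2 powr K * (t powr (2 * H * K) + s powr (2 * H * K))"

text \<open>In terms of \<open>p = t powr H\<close> and \<open>q = s powr H\<close> the variance is
  the Jensen gap above, and \<open>p - q\<close> is controlled by the power increment bound. The
  exponents of \<open>s\<close> add up:
  \<open>H * (2 * K - 2) + (2 * H - 2) = 2 * H * K - 2\<close>.\<close>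

lemma trifractional_increment_variance_le:
  assumes "0 < s" "s \<le> t" "0 < H" "H \<le> 1" "0 \<le> K" "K \<le> 1"
  shows "trifractional_increment_variance H K s t \<le> 2 * s powr (2 * H * K - 2) * (t - s)\<^sup>2"
proof -
  define p q where "p = t powr H" and "q = s powr H"
  have "0 < q" "q \<le> p" using assms by (auto simp: p_def q_def intro!: powr_mono2)
  have eq: "t powr (2 * H) = p\<^sup>2" "s powr (2 * H) = q\<^sup>2"
    "t powr (2 * H * K) = p powr (2 * K)" "s powr (2 * H * K) = q powr (2 * K)"
    using assms by (simp_all add: p_def q_def powr_power powr_powr mult_ac)
  have "trifractional_increment_variance H K s t \<le> 2 * q powr (2 * K - 2) * (p - q)\<^sup>2"
    unfolding trifractional_increment_variance_def eq
    using jensen_gap_powr_le[OF \<open>0 < q\<close> \<open>q \<le> p\<close>] assms by simp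
  also have "\<dots> \<le> 2 * q powr (2 * K - 2) * (s powr (H - 1) * (t - s))\<^sup>2"
    using powr_increment_le[of s t H] \<open>q \<le> p\<close> assms
    by (intro mult_left_mono power_mono) (auto simp: p_def q_def)
  also have "\<dots> = 2 * (q powr (2 * K - 2) * (s powr (H - 1))\<^sup>2) * (t - s)\<^sup>2"
    by (simp only: power_mult_distrib mult.assoc)
  also have "(s powr (H - 1))\<^sup>2 = s powr (2 * H - 2)"
    using assms by (simp add: powr_power algebra_simps)
  also have "q powr (2 * K - 2) * s powr (2 * H - 2) = s powr (2 * H * K - 2)"
    using assms by (simp add: q_def powr_powr powr_add[symmetric] algebra_simps)
  finally show ?thesis .
qed

text \<open>Each dyadic block from \<open>2 ^ n\<close> to \<open>2 ^ Suc n\<close> has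
  \<open>2 ^ n\<close> terms of size at most \<open>1 / 2 ^ n\<close>, hence contributes at most
  1.\<close>

lemma dyadic_harmonic_sum_le: "(\<Sum>k = 1..<2 ^ n. 1 / real k) \<le> real n"
proof (induction n)
  case (Suc n)
  have "(\<Sum>k = 2 ^ n..<2 ^ Suc n. 1 / real k) \<le> (\<Sum>k = 2 ^ n..<(2::nat) ^ Suc n. 1 / 2 ^ n)"
  proof (intro sum_mono frac_le)
    fix k :: nat assume "k \<in> {2 ^ n..<2 ^ Suc n}"
    then show "2 ^ n \<le> real k" using of_nat_mono[of "2 ^ n" k, where 'a = real] by simp
  qed auto
  also have "\<dots> = 1" by simp
  finally have "(\<Sum>k = 2 ^ n..<2 ^ Suc n. 1 / real k) \<le> 1" .
  moreover have "(\<Sum>k = 1..<2 ^ Suc n. 1 / real k)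
      = (\<Sum>k = 1..<2 ^ n. 1 / real k) + (\<Sum>k = 2 ^ n..<2 ^ Suc n. 1 / real k)"
    by (rule sum.atLeastLessThan_concat[symmetric]) auto
  ultimately show ?case using Suc by simp
qed simp

section \<open>Increments of the process\<close>

lemma trifractional_increment_gaussian:
  assumes "trifractional_brownian_motion H K M Z" "0 \<le> s" "0 \<le> t" "s \<noteq> t"
  shows "gaussian_rv M (\<lambda>\<omega>. Z t \<omega> - Z s \<omega>)"
proof -
  have *: "gaussian_process M {0..} Z"
    using assms(1) by (simp add: trifractional_brownian_motion_def)
  \<comment> \<open>Coefficients 1 and -1 on a two-point set of times yield the increment;
    \<open>s \<noteq> t\<close> keeps the two terms apart.\<close>
  have "gaussian_rv M (\<lambda>\<omega>. \<Sum>u\<in>{s, t}. (if u = t then 1 else - 1) * Z u \<omega>)"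
    using * assms(2,3) unfolding gaussian_process_def
    by (elim conjE allE[of _ "{s, t}"] allE[of _ "\<lambda>u. if u = t then 1 else - 1"]) auto
  then show ?thesis using \<open>s \<noteq> t\<close> by simp
qed

lemma trifractional_square_integrable:
  assumes "trifractional_brownian_motion H K M Z" "0 \<le> t"
  shows "integrable M (\<lambda>\<omega>. (Z t \<omega>)\<^sup>2)"
proof -
  have *: "gaussian_process M {0..} Z"
    using assms(1) by (simp add: trifractional_brownian_motion_def)
  have "gaussian_rv M (\<lambda>\<omega>. \<Sum>u\<in>{t}. 1 * Z u \<omega>)"
    using * assms(2) unfolding gaussian_process_def
    by (elim conjE allE[of _ "{t}"] allE[of _ "\<lambda>_. 1"]) auto
  then show ?thesis
    using * by (intro gaussian_rv_square_integrable) (simp_all add: gaussian_process_def)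
qed

text \<open>Expanding the square reduces everything to the given covariances. As the means vanish,
  covariances are plain expectations of products, and the second moment of the increment is its
  variance.\<close>

lemma trifractional_increment:
  assumes Z: "trifractional_brownian_motion H K M Z" and "0 \<le> s" "0 \<le> t" "s \<noteq> t"
  shows "integrable M (\<lambda>\<omega>. (Z t \<omega> - Z s \<omega>)\<^sup>2)" (is ?int)
    and "(\<integral>\<omega>. (Z t \<omega> - Z s \<omega>)\<^sup>2 \<partial>M) = trifractional_increment_variance H K s t" (is ?var)
    and "covariance M (\<lambda>\<omega>. Z t \<omega> - Z s \<omega>) (\<lambda>\<omega>. Z t \<omega> - Z s \<omega>)
      = trifractional_increment_variance H K s t" (is ?cov)
proof -
  interpret prob_space M
    using Z by (simp add: trifractional_brownian_motion_def gaussian_process_def)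
  have [measurable]: "Z u \<in> borel_measurable M" if "u \<ge> 0" for u
    using Z that by (simp add: trifractional_brownian_motion_def gaussian_process_def)
  note sq = trifractional_square_integrable[OF Z \<open>0 \<le> s\<close>] trifractional_square_integrable[OF Z \<open>0 \<le> t\<close>]
  have int: "integrable M (Z s)" "integrable M (Z t)"
    using sq assms by (auto intro: square_integrable_imp_integrable)
  have mean: "expectation (Z s) = 0" "expectation (Z t) = 0"
    using Z assms by (auto simp: trifractional_brownian_motion_def)
  show ?int
    by (rule gaussian_rv_square_integrable[OF prob_space_axioms
          trifractional_increment_gaussian[OF assms]])
  \<comment> \<open>Polarization: the product is a combination of three integrable squares.\<close>
  then have "integrable M (\<lambda>\<omega>. ((Z s \<omega>)\<^sup>2 + (Z t \<omega>)\<^sup>2 - (Z t \<omega> - Z s \<omega>)\<^sup>2) / 2)"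
    using sq by simp
  also have "(\<lambda>\<omega>. ((Z s \<omega>)\<^sup>2 + (Z t \<omega>)\<^sup>2 - (Z t \<omega> - Z s \<omega>)\<^sup>2) / 2) = (\<lambda>\<omega>. Z s \<omega> * Z t \<omega>)"
    by (simp add: fun_eq_iff power2_eq_square algebra_simps)
  finally have prod: "integrable M (\<lambda>\<omega>. Z s \<omega> * Z t \<omega>)" .
  have cov: "trifractional_cov H K s s = expectation (\<lambda>\<omega>. (Z s \<omega>)\<^sup>2)"
    "trifractional_cov H K t t = expectation (\<lambda>\<omega>. (Z t \<omega>)\<^sup>2)"
    "trifractional_cov H K s t = expectation (\<lambda>\<omega>. Z s \<omega> * Z t \<omega>)"
    using Z assms mean
    by (auto simp: trifractional_brownian_motion_def covariance_def power2_eq_square)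
  have "expectation (\<lambda>\<omega>. (Z t \<omega> - Z s \<omega>)\<^sup>2)
      = expectation (\<lambda>\<omega>. (Z t \<omega>)\<^sup>2 + (Z s \<omega>)\<^sup>2 - 2 * (Z s \<omega> * Z t \<omega>))"
    by (simp add: power2_eq_square algebra_simps)
  also have "\<dots> = trifractional_cov H K t t + trifractional_cov H K s s - 2 * trifractional_cov H K s t"
    unfolding cov using sq prod by simp
  \<comment> \<open>On the diagonal the sum of two equal powers doubles, which produces the factor
    \<open>2 powr K\<close>.\<close>
  also have "\<dots> = trifractional_increment_variance H K s t"
    using assms unfolding trifractional_cov_def trifractional_increment_variance_def
    by (simp add: powr_mult powr_powr algebra_simps flip: mult_2)
  finally show ?var .
  then show ?cov
    using int mean by (simp add: covariance_def power2_eq_square)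
qed

text \<open>The increment starting at the origin is handled exactly, since the general bound is
  singular at \<open>s = 0\<close>. The convention \<open>0 powr a = 0\<close> removes the terms in
  \<open>s\<close>.\<close>

lemma trifractional_increment_variance_zero:
  assumes "0 \<le> h"
  shows "trifractional_increment_variance H K 0 h = (2 - 2 powr K) * h powr (2 * H * K)"
  using assms by (simp add: trifractional_increment_variance_def powr_powr algebra_simps)

section \<open>Almost sure bounds for the dyadic sum of squares\<close>

definition dyadic_qv :: "real \<Rightarrow> (real \<Rightarrow> real) \<Rightarrow> nat \<Rightarrow> real" where
  "dyadic_qv T x n = (\<Sum>k = 1..2 ^ n. (x (real k * T / 2 ^ n) - x ((real k - 1) * T / 2 ^ n))\<^sup>2)"

lemma log_dyadic_qv_eq: "log_dyadic_qv T x n = 1 / (2 * real n) * log 2 (dyadic_qv T x n)"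
  by (simp add: log_dyadic_qv_def dyadic_qv_def)

lemma trifractional_dyadic_qv_integrable:
  assumes Z: "trifractional_brownian_motion H K M Z" and "T > 0"
  shows "integrable M (\<lambda>\<omega>. dyadic_qv T (\<lambda>t. Z t \<omega>) n)"
  unfolding dyadic_qv_def using assms(2)
  by (intro Bochner_Integration.integrable_sum trifractional_increment(1)[OF Z]) auto

lemma trifractional_dyadic_qv_expectation_le:
  assumes Z: "trifractional_brownian_motion H K M Z" and "T > 0" "H * K \<le> 1 / 2"
  shows "(\<integral>\<omega>. dyadic_qv T (\<lambda>t. Z t \<omega>) n \<partial>M) \<le> 2 * (real n + 1) * (T / 2 ^ n) powr (2 * H * K)"
proof -
  have HK: "0 < H" "H < 1" "0 < K" "K < 1"
    using Z by (auto simp: trifractional_brownian_motion_def)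
  define h where "h = T / 2 ^ n"
  have "h > 0" using \<open>T > 0\<close> by (simp add: h_def)
  define f where "f k = trifractional_increment_variance H K ((real k - 1) * h) (real k * h)" for k :: nat
  have "(\<integral>\<omega>. dyadic_qv T (\<lambda>t. Z t \<omega>) n \<partial>M) = (\<Sum>k = 1..2 ^ n. f k)"
    unfolding dyadic_qv_def f_def h_def
    using \<open>T > 0\<close>
    by (subst Bochner_Integration.integral_sum)
       (auto intro!: sum.cong trifractional_increment[OF Z, of "(real _ - 1) * T / 2 ^ n", simplified]
             simp: trifractional_increment[OF Z])
  \<comment> \<open>The term starting at time 0 is split off. After the shift, the increment with
    index \<open>Suc k\<close> has the positive left endpoint \<open>k * h\<close>.\<close>
  also have "\<dots> = f 1 + (\<Sum>k = 1..<2 ^ n. f (Suc k))"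
    by (simp add: sum.atLeast_Suc_atMost sum.shift_bounds_Suc_ivl[symmetric] atLeastLessThanSuc_atLeastAtMost)
  also have "f 1 \<le> 2 * h powr (2 * H * K)"
    using \<open>h > 0\<close> trifractional_increment_variance_zero[of h H K]
    by (auto simp: f_def intro!: mult_right_mono)
  also have "(\<Sum>k = 1..<2 ^ n. f (Suc k)) \<le> (\<Sum>k = 1..<2 ^ n. 2 * h powr (2 * H * K) * (1 / real k))"
  proof (intro sum_mono)
    fix k :: nat assume "k \<in> {1..<2 ^ n}"
    then have k: "1 \<le> real k" by simp
    have "f (Suc k) \<le> 2 * (real k * h) powr (2 * H * K - 2) * (real (Suc k) * h - real k * h)\<^sup>2"
      unfolding f_def using k \<open>h > 0\<close> HK trifractional_increment_variance_le[of "real k * h" "real (Suc k) * h" H K]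
      by simp
    also have "\<dots> = 2 * (real k powr (2 * H * K - 2) * h powr (2 * H * K))"
      using \<open>h > 0\<close> k by (simp add: powr_mult powr_diff algebra_simps)
    \<comment> \<open>Here \<open>H * K \<le> 1 / 2\<close> gives
      \<open>2 * H * K - 2 \<le> - 1\<close>, so the sum is dominated by a harmonic one.\<close>
    also have "\<dots> \<le> 2 * (real k powr (- 1) * h powr (2 * H * K))"
      using k assms(3) by (intro mult_left_mono mult_right_mono powr_mono) auto
    also have "\<dots> = 2 * h powr (2 * H * K) * (1 / real k)"
      using k by (simp add: powr_minus field_simps)
    finally show "f (Suc k) \<le> 2 * h powr (2 * H * K) * (1 / real k)" .
  qed
  also have "\<dots> = 2 * h powr (2 * H * K) * (\<Sum>k = 1..<2 ^ n. 1 / real k)"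
    by (simp add: sum_distrib_left)
  also have "\<dots> \<le> 2 * h powr (2 * H * K) * real n"
    by (intro mult_left_mono dyadic_harmonic_sum_le) auto
  finally show ?thesis by (simp add: h_def algebra_simps)
qed

text \<open>The majorant for both Borel-Cantelli arguments, with \<open>C = 2\<close> for the upper
  bound and \<open>C = 1\<close> for the lower one.\<close>

lemma summable_inverse_Suc_square: "summable (\<lambda>n. C / (real n + 1)\<^sup>2)"
proof -
  have "summable (\<lambda>n. C * (1 / real (Suc n) ^ 2))"
    by (intro summable_mult) (subst summable_Suc_iff[of "\<lambda>n. 1 / real n ^ 2"],
        simp add: inverse_power_summable flip: inverse_eq_divide)
  then show ?thesis by (simp add: add.commute)
qed

lemma trifractional_dyadic_qv_upper:
  assumes Z: "trifractional_brownian_motion H K M Z" and "T > 0" "H * K \<le> 1 / 2"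
  shows "AE \<omega> in M. \<forall>\<^sub>F n in sequentially.
    dyadic_qv T (\<lambda>t. Z t \<omega>) n \<le> (real n + 1) ^ 3 * (T / 2 ^ n) powr (2 * H * K)"
proof -
  interpret prob_space M
    using Z by (simp add: trifractional_brownian_motion_def gaussian_process_def)
  note [measurable] = borel_measurable_integrable[OF trifractional_dyadic_qv_integrable[OF Z \<open>T > 0\<close>]]
  \<comment> \<open>One factor \<open>real n + 1\<close> matches the bound on the expectation; the
    other two make the Markov bound summable.\<close>
  define b where "b n = (real n + 1) ^ 3 * (T / 2 ^ n) powr (2 * H * K)" for n
  have b: "b n > 0" for n using \<open>T > 0\<close> by (simp add: b_def)
  define A where "A n = {\<omega> \<in> space M. b n \<le> dyadic_qv T (\<lambda>t. Z t \<omega>) n}" for n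
  have "prob (A n) \<le> 2 / (real n + 1)\<^sup>2" for n
  proof -
    have "prob (A n) \<le> expectation (\<lambda>\<omega>. dyadic_qv T (\<lambda>t. Z t \<omega>) n) / b n"
      unfolding A_def
      by (rule integral_Markov_inequality_measure[OF trifractional_dyadic_qv_integrable[OF Z \<open>T > 0\<close>] sets.empty_sets _ b])
         (auto simp: dyadic_qv_def intro!: sum_nonneg)
    also have "\<dots> \<le> 2 * (real n + 1) * (T / 2 ^ n) powr (2 * H * K) / b n"
      using trifractional_dyadic_qv_expectation_le[OF assms] less_imp_le[OF b] by (intro divide_right_mono)
    also have "\<dots> = 2 / (real n + 1)\<^sup>2"
    proof -
      have "2 * m * p / (m ^ 3 * p) = 2 / m\<^sup>2" if "m > 0" "p > 0" for m p :: real
        using that by (simp add: power2_eq_square power3_eq_cube)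
      then show ?thesis using \<open>T > 0\<close> by (simp add: b_def del: distrib_left_numeral)
    qed
    finally show ?thesis .
  qed
  then have "summable (\<lambda>n. prob (A n))"
    by (intro summable_comparison_test'[OF summable_inverse_Suc_square[of 2]]) auto
  then have "AE \<omega> in M. \<forall>\<^sub>F n in sequentially. \<omega> \<in> space M - A n"
    by (intro borel_cantelli_AE1) (auto simp: A_def emeasure_eq_measure)
  then show ?thesis
  proof eventually_elim
    case (elim \<omega>)
    then show ?case
      by (rule eventually_mono) (auto simp: A_def b_def)
  qed
qed

text \<open>The first summand alone suffices. A ball of radius
  \<open>1 / (real n + 1)\<^sup>2\<close> standard deviations has summable probability, and squaring
  the radius produces the fourth power.\<close>

lemma trifractional_dyadic_qv_lower:
  assumes Z: "trifractional_brownian_motion H K M Z" and "T > 0"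
  shows "AE \<omega> in M. \<forall>\<^sub>F n in sequentially.
    (2 - 2 powr K) * (T / 2 ^ n) powr (2 * H * K) / (real n + 1) ^ 4 < dyadic_qv T (\<lambda>t. Z t \<omega>) n"
proof -
  interpret prob_space M
    using Z by (simp add: trifractional_brownian_motion_def gaussian_process_def)
  have [measurable]: "Z u \<in> borel_measurable M" if "u \<ge> 0" for u
    using Z that by (simp add: trifractional_brownian_motion_def gaussian_process_def)
  \<comment> \<open>Since \<open>K < 1\<close>, the variance of the first increment is strictly
    positive.\<close>
  have "2 powr K < 2 powr 1"
    using Z by (intro powr_less_mono) (auto simp: trifractional_brownian_motion_def)
  then have K: "2 powr K < 2" by simp
  define h where "h n = T / 2 ^ n" for n :: nat
  have h: "h n > 0" for n using \<open>T > 0\<close> by (simp add: h_def)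
  define X where "X n \<omega> = Z (h n) \<omega> - Z 0 \<omega>" for n \<omega>
  have [measurable]: "X n \<in> borel_measurable M" for n
    using less_imp_le[OF h] unfolding X_def by measurable
  define v where "v n = (2 - 2 powr K) * h n powr (2 * H * K)" for n
  have v: "v n > 0" for n using K h[of n] by (simp add: v_def)
  have cov: "covariance M (X n) (X n) = v n" for n
    using trifractional_increment(3)[OF Z, of 0 "h n"] h[of n]
    unfolding X_def v_def by (simp add: trifractional_increment_variance_zero)
  define A where "A n = {\<omega> \<in> space M. \<bar>X n \<omega>\<bar> \<le> 1 / (real n + 1)\<^sup>2 * sqrt (v n)}" for n
  have "gaussian_rv M (X n)" for n
    using trifractional_increment_gaussian[OF Z, of 0 "h n"] h[of n] by (simp add: X_def[abs_def])
  then have "prob (A n) \<le> 1 / (real n + 1)\<^sup>2" for n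
    using gaussian_rv_small_ball[OF prob_space_axioms, of "X n" "1 / (real n + 1)\<^sup>2"] v[of n]
    unfolding A_def cov by simp
  then have "summable (\<lambda>n. prob (A n))"
    by (intro summable_comparison_test'[OF summable_inverse_Suc_square[of 1]]) auto
  then have ae: "AE \<omega> in M. \<forall>\<^sub>F n in sequentially. \<omega> \<in> space M - A n"
    by (intro borel_cantelli_AE1) (auto simp: A_def emeasure_eq_measure)
  have lower: "v n / (real n + 1) ^ 4 < dyadic_qv T (\<lambda>t. Z t \<omega>) n"
    if "\<omega> \<in> space M - A n" for n \<omega>
  proof -
    have "1 / (real n + 1)\<^sup>2 * sqrt (v n) < \<bar>X n \<omega>\<bar>" using that by (auto simp: A_def)
    then have "(1 / (real n + 1)\<^sup>2 * sqrt (v n))\<^sup>2 < \<bar>X n \<omega>\<bar>\<^sup>2"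
      using v[of n] by (intro power_strict_mono) auto
    then have "v n / (real n + 1) ^ 4 < (X n \<omega>)\<^sup>2"
      using v[of n] by (simp add: power_mult_distrib power_divide flip: power_mult)
    also have "(X n \<omega>)\<^sup>2 \<le> dyadic_qv T (\<lambda>t. Z t \<omega>) n"
      unfolding dyadic_qv_def X_def h_def
      by (rule order_trans[OF _ member_le_sum[of 1]]) auto
    finally show ?thesis .
  qed
  show ?thesis
    using ae
  proof eventually_elim
    case (elim \<omega>)
    then show ?case
      by (rule eventually_mono) (use lower in \<open>simp add: v_def h_def\<close>)
  qed
qed

section \<open>Logarithmic asymptotics and the limit\<close>

text \<open>After taking logarithms, constants and polynomial factors contribute only
  \<open>O(log n)\<close>, which disappears on division by \<open>2 * n\<close>. The scale
  contributes \<open>2 * a * (log 2 T - n)\<close>, whence the limit \<open>- a\<close>.\<close>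

lemma log_dyadic_scale_tendsto:
  fixes q :: "nat \<Rightarrow> real"
  assumes "T > 0" "c > 0" "C > 0"
    and lower: "\<forall>\<^sub>F n in sequentially. c * (T / 2 ^ n) powr (2 * a) / (real n + 1) ^ j \<le> q n"
    and upper: "\<forall>\<^sub>F n in sequentially. q n \<le> C * (real n + 1) ^ k * (T / 2 ^ n) powr (2 * a)"
  shows "(\<lambda>n. 1 / (2 * real n) * log 2 (q n)) \<longlonglongrightarrow> - a"
proof (rule tendsto_sandwich)
  have lim: "(\<lambda>n. 1 / (2 * real n) * (L + b * log 2 (real n + 1) + 2 * a * (D - real n))) \<longlonglongrightarrow> - a"
    for L b D :: real
    by real_asymp
  show "(\<lambda>n. 1 / (2 * real n) * (log 2 c + (- real j) * log 2 (real n + 1) + 2 * a * (log 2 T - real n))) \<longlonglongrightarrow> - a"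
    and "(\<lambda>n. 1 / (2 * real n) * (log 2 C + real k * log 2 (real n + 1) + 2 * a * (log 2 T - real n))) \<longlonglongrightarrow> - a"
    by (rule lim)+
  have lh: "log 2 ((T / 2 ^ n) powr (2 * a)) = 2 * a * (log 2 T - real n)" for n
    using \<open>T > 0\<close> by (simp add: log_powr log_divide log_nat_power)
  have pos: "c * (T / 2 ^ n) powr (2 * a) / (real n + 1) ^ j > 0" for n
    using assms by simp
  show "\<forall>\<^sub>F n in sequentially. 1 / (2 * real n) * (log 2 c + (- real j) * log 2 (real n + 1) + 2 * a * (log 2 T - real n))
      \<le> 1 / (2 * real n) * log 2 (q n)"
    using lower
  proof eventually_elim
    case (elim n)
    have "log 2 c + (- real j) * log 2 (real n + 1) + 2 * a * (log 2 T - real n)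
        = log 2 (c * (T / 2 ^ n) powr (2 * a) / (real n + 1) ^ j)"
      using assms by (simp add: log_mult log_divide log_nat_power lh)
    also have "\<dots> \<le> log 2 (q n)"
      using elim pos[of n] by (subst log_le_cancel_iff) auto
    finally show ?case by (intro mult_left_mono) auto
  qed
  show "\<forall>\<^sub>F n in sequentially. 1 / (2 * real n) * log 2 (q n)
      \<le> 1 / (2 * real n) * (log 2 C + real k * log 2 (real n + 1) + 2 * a * (log 2 T - real n))"
    \<comment> \<open>The lower bound enters here too: it makes \<open>q n\<close> positive, as
      monotonicity of the logarithm requires.\<close>
    using lower upper
  proof eventually_elim
    case (elim n)
    have "log 2 (q n) \<le> log 2 (C * (real n + 1) ^ k * (T / 2 ^ n) powr (2 * a))"
      using elim pos[of n] by (subst log_le_cancel_iff) auto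
    also have "\<dots> = log 2 C + real k * log 2 (real n + 1) + 2 * a * (log 2 T - real n)"
      using assms by (simp add: log_mult log_nat_power lh)
    finally show ?case by (intro mult_left_mono) auto
  qed
qed

lemma trifractional_log_dyadic_qv_tendsto:
  assumes Z: "trifractional_brownian_motion H K M Z" and "T > 0" "H * K \<le> 1 / 2"
  shows "AE \<omega> in M. log_dyadic_qv T (\<lambda>t. Z t \<omega>) \<longlonglongrightarrow> - (H * K)"
proof -
  have "2 powr K < 2 powr 1"
    using Z by (intro powr_less_mono) (auto simp: trifractional_brownian_motion_def)
  then have K: "2 - 2 powr K > 0" by simp
  show ?thesis
    using trifractional_dyadic_qv_upper[OF assms] trifractional_dyadic_qv_lower[OF Z \<open>T > 0\<close>]
  proof eventually_elim
    case (elim \<omega>)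
    have "(\<lambda>n. 1 / (2 * real n) * log 2 (dyadic_qv T (\<lambda>t. Z t \<omega>) n)) \<longlonglongrightarrow> - (H * K)"
    \<comment> \<open>The constants are \<open>2 - 2 powr K\<close> below and 1 above; the
      polynomial exponents are 4 and 3.\<close>
    proof (rule log_dyadic_scale_tendsto[OF \<open>T > 0\<close> K zero_less_one])
      show "\<forall>\<^sub>F n in sequentially. (2 - 2 powr K) * (T / 2 ^ n) powr (2 * (H * K)) / (real n + 1) ^ 4
          \<le> dyadic_qv T (\<lambda>t. Z t \<omega>) n"
        using elim(2) by (auto elim!: eventually_mono simp: mult.assoc)
      show "\<forall>\<^sub>F n in sequentially. dyadic_qv T (\<lambda>t. Z t \<omega>) n
          \<le> 1 * (real n + 1) ^ 3 * (T / 2 ^ n) powr (2 * (H * K))"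
        using elim(1) by (auto elim!: eventually_mono simp: mult.assoc)
    qed
    then show ?case by (simp add: log_dyadic_qv_eq[abs_def])
  qed
qed

theorem corollary2p6:
  fixes H K T :: real and M :: "'a measure" and Z :: "real \<Rightarrow> 'a \<Rightarrow> real"
  assumes "0 < H" "H < 1" "0 < K" "K < 1"
    and "trifractional_brownian_motion H K M Z"
    and "T > 0"
    and "H * K \<le> 1 / 2"
    and "AE \<omega> in M. convergent (log_dyadic_qv T (\<lambda>t. Z t \<omega>))"
  shows "AE \<omega> in M. - lim (log_dyadic_qv T (\<lambda>t. Z t \<omega>)) = H * K"
  using trifractional_log_dyadic_qv_tendsto[OF assms(5,6,7)]
  by eventually_elim (auto dest: limI)

end
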